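(* Let $n\ge 2$ be an integer, let $m\le M$ be real numbers and let $x_1,\dots,x_n$ be real numbers, not all equal, with $m\le x_i\le M$ for $i=1,\dots,n$. Let $\overline{x}=\frac1n\sum_{i=1}^n x_i$ and $m_r=\frac1n\sum_{i=1}^n (x_i-\overline{x})^r$ for $r=2,4$. Then $$\frac{m_2^4}{m_4}\le \frac{(n-1)^3}{n^2-3n+3}(\overline{x}-m)^4\quad\text{and}\quad \frac{m_2^4}{m_4}\le \frac{(n-1)^3}{n^2-3n+3}(M-\overline{x})^4.$$
   Context: $m_r$ (with a subscript) denotes the $r$-th central moment of $x_1,\dots,x_n$; $m$ (without subscript) is a lower bound for the $x_i$. *)

theory Defs
  imports Complex_Main
begin

definition amean :: "nat \<Rightarrow> (nat \<Rightarrow> real) \<Rightarrow> real" where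
  "amean n x = (1 / real n) * (\<Sum>i=1..n. x i)"

definition central_moment :: "nat \<Rightarrow> nat \<Rightarrow> (nat \<Rightarrow> real) \<Rightarrow> real" where
  "central_moment r n x = (1 / real n) * (\<Sum>i=1..n. (x i - amean n x) ^ r)"

end

theory Submission
  imports Defs
begin

text \<open>
  Let \<open>y\<close> be the deviations from the mean, \<open>a\<close> a bound with \<open>y \<ge> -a\<close>, and \<open>v\<close>, \<open>w\<close> the second and
  fourth moments of \<open>y\<close>. As the \<open>y\<close> sum to zero, each is at most \<open>k a\<close> with \<open>k = n - 1\<close>, and
  averaging \<open>(y + a) (y - k a) \<le> 0\<close> gives \<open>v \<le> k a\<^sup>2\<close>. If \<open>v \<ge> a\<^sup>2\<close>, put \<open>b = v / a\<close>; averaging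
  \<open>(y - b)\<^sup>2 (y + a) (y + 2 b - a) \<ge> 0\<close>, a quartic without cubic term, gives
  \<open>w \<ge> a b (a\<^sup>2 - a b + b\<^sup>2)\<close>, and the ratio bound follows because \<open>t\<^sup>3 / (t\<^sup>2 - t + 1)\<close> is
  increasing in \<open>t = v / a\<^sup>2\<close>. If \<open>v < a\<^sup>2\<close>, then \<open>w \<ge> v\<^sup>2\<close> is enough.
  The bound with \<open>M\<close> is the same statement for \<open>-y\<close>.
\<close>

text \<open>Cross-multiplied, so no sign condition on \<open>s\<close>, \<open>t\<close> is needed:
  the difference of the two sides is \<open>t - s\<close> times half a sum of four squares.\<close>

lemma cubic_quadratic_quotient_mono:
  fixes s t :: real
  assumes "s \<le> t"
  shows "s^3 * (t^2 - t + 1) \<le> t^3 * (s^2 - s + 1)"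
proof -
  have "t^3 * (s^2 - s + 1) - s^3 * (t^2 - t + 1)
      = (t - s) * (((t * s - t - s)^2 + (t * s)^2 + t^2 + s^2) / 2)"
    by (simp add: field_simps power2_eq_square power3_eq_cube)
  moreover have "\<dots> \<ge> 0"
    using assms by (intro mult_nonneg_nonneg) simp_all
  ultimately show ?thesis by linarith
qed

lemma second_moment_le:
  fixes y :: "'a \<Rightarrow> real"
  assumes "finite A" "sum y A = 0" and lb: "\<And>i. i \<in> A \<Longrightarrow> - a \<le> y i"
  shows "(\<Sum>i\<in>A. (y i)^2) \<le> real (card A) * ((real (card A) - 1) * a^2)"
proof -
  define k where "k = real (card A) - 1"
  have ub: "y i \<le> k * a" if "i \<in> A" for i
  proof -
    \<comment> \<open>The other deviations, \<open>k\<close> in number, add up to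
      \<open>- y i\<close>, and each is at least \<open>- a\<close>.\<close>
    have "(\<Sum>j\<in>A - {i}. - a) \<le> (\<Sum>j\<in>A - {i}. y j)"
      by (rule sum_mono) (use lb in auto)
    also have "\<dots> = - y i"
      using assms that by (simp add: sum_diff1)
    finally have "- (real (card (A - {i})) * a) \<le> - y i" by simp
    moreover have "card A \<ge> 1"
      using assms(1) that card_gt_0_iff[of A] by auto
    then have "real (card (A - {i})) = k"
      using assms(1) that by (simp add: k_def of_nat_diff)
    ultimately show ?thesis by simp
  qed
  have "(y i)^2 \<le> k * a^2 + (k - 1) * a * y i" if "i \<in> A" for i
  proof -
    have "(y i + a) * (k * a - y i) \<ge> 0"
      using lb[OF that] ub[OF that] by (intro mult_nonneg_nonneg) auto
    then show ?thesis by (simp add: algebra_simps power2_eq_square)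
  qed
  then have "(\<Sum>i\<in>A. (y i)^2) \<le> (\<Sum>i\<in>A. k * a^2 + (k - 1) * a * y i)"
    by (rule sum_mono)
  also have "\<dots> = real (card A) * (k * a^2)"
    using assms(2) by (simp add: sum.distrib flip: sum_distrib_left)
  finally show ?thesis by (simp add: k_def)
qed

text \<open>The quartic has a double root at \<open>b\<close> and a simple one at
  \<open>- a\<close>; its last root \<open>a - 2 * b\<close> makes the roots sum to zero, so no
  third moment enters. As \<open>a \<le> b\<close>, that root is at most \<open>- a\<close>. The
  linear term drops out on summing.\<close>

lemma fourth_moment_ge:
  fixes y :: "'a \<Rightarrow> real"
  assumes "sum y A = 0" and lb: "\<And>i. i \<in> A \<Longrightarrow> - a \<le> y i"
    and b: "a \<le> b"
  shows "(3 * b^2 - a * (2 * b - a)) * (\<Sum>i\<in>A. (y i)^2)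
           - real (card A) * (a * b^2 * (2 * b - a)) \<le> (\<Sum>i\<in>A. (y i)^4)"
proof -
  define p where "p = 3 * b^2 - a * (2 * b - a)"
  define q where "q = 2 * b * (b - a)^2"
  define r where "r = a * b^2 * (2 * b - a)"
  have "p * (y i)^2 - q * y i - r \<le> (y i)^4" if "i \<in> A" for i
  proof -
    have "(y i - b)^2 * ((y i + a) * (y i + 2 * b - a)) \<ge> 0"
      using lb[OF that] b by (intro mult_nonneg_nonneg) auto
    also have "(y i - b)^2 * ((y i + a) * (y i + 2 * b - a))
        = (y i)^4 - (p * (y i)^2 - q * y i - r)"
      unfolding p_def q_def r_def
      by (simp add: algebra_simps power2_eq_square power4_eq_xxxx)
    finally show ?thesis by simp
  qed
  then have "(\<Sum>i\<in>A. p * (y i)^2 - q * y i - r) \<le> (\<Sum>i\<in>A. (y i)^4)"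
    by (rule sum_mono)
  moreover have "(\<Sum>i\<in>A. p * (y i)^2 - q * y i - r)
      = p * (\<Sum>i\<in>A. (y i)^2) - real (card A) * r"
    using assms(1) by (simp add: sum_subtractf flip: sum_distrib_left)
  ultimately show ?thesis by (simp add: p_def r_def)
qed

lemma moment_ratio_le:
  fixes y :: "'a \<Rightarrow> real" and a :: real and A :: "'a set"
  defines "v \<equiv> (\<Sum>i\<in>A. (y i)^2) / real (card A)"
    and "w \<equiv> (\<Sum>i\<in>A. (y i)^4) / real (card A)"
    and "N \<equiv> real (card A)"
  assumes fin: "finite A" and sum0: "sum y A = 0"
    and lb: "\<And>i. i \<in> A \<Longrightarrow> - a \<le> y i" and nz: "\<exists>i\<in>A. y i \<noteq> 0"
  shows "v^4 / w \<le> (N - 1)^3 / (N^2 - 3 * N + 3) * a^4"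
proof -
  define k where "k = N - 1"
  have Npos: "real (card A) > 0"
    using fin nz card_gt_0_iff[of A] by auto
  obtain i where i: "i \<in> A" "y i \<noteq> 0" using nz by blast
  have "(\<Sum>i\<in>A. (y i)^2) > 0"
    using fin i by (intro sum_pos2[of A i]) auto
  then have vpos: "v > 0" using Npos by (simp add: v_def)
  have "(\<Sum>i\<in>A. (y i)^4) > 0"
    using fin i by (intro sum_pos2[of A i]) auto
  then have wpos: "w > 0" using Npos by (simp add: w_def)
  have S2: "(\<Sum>i\<in>A. (y i)^2) = real (card A) * v"
    and S4: "(\<Sum>i\<in>A. (y i)^4) = real (card A) * w"
    using Npos by (simp_all add: v_def w_def)
  have vk: "v \<le> k * a^2"
    using second_moment_le[OF fin sum0 lb] Npos by (simp add: S2 k_def N_def)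
  have apos: "a > 0"
  proof (rule ccontr)
    assume "\<not> a > 0"
    then have "y j \<ge> 0" if "j \<in> A" for j using lb[OF that] by linarith
    then show False using sum_nonneg_eq_0_iff[OF fin] sum0 i by auto
  qed
  define t where "t = v / a^2"
  have vt: "v = t * a^2" and tpos: "t > 0" and tk: "t \<le> k"
    using apos vpos vk by (auto simp: t_def field_simps)
  have k1: "k \<ge> 1"
  proof -
    have "k > 0" using tpos tk by simp
    \<comment> \<open>\<open>k\<close> is an integer, so positivity already gives
      \<open>k \<ge> 1\<close>.\<close>
    then show ?thesis by (simp add: k_def N_def)
  qed
  have kq: "k^2 - k + 1 > 0" using k1 self_le_power[OF k1, of 2] by simp
  have key: "v^4 * (k^2 - k + 1) \<le> k^3 * a^4 * w"
  proof (cases "t \<ge> 1")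
    case True
    \<comment> \<open>Here \<open>b = t * a = v / a\<close>: a mean-zero variable with values
      \<open>- a\<close> and \<open>b\<close> has variance \<open>a * b\<close>.\<close>
    have "a \<le> t * a" using True apos by simp
    from fourth_moment_ge[OF sum0 lb this]
    have "real (card A) * (t * (t^2 - t + 1) * a^4) \<le> real (card A) * w"
      unfolding S2 S4 by (simp add: vt algebra_simps power2_eq_square power4_eq_xxxx)
    then have w_ge: "t * (t^2 - t + 1) * a^4 \<le> w" using Npos by simp
    have "v^4 * (k^2 - k + 1) = (t * a^8) * (t^3 * (k^2 - k + 1))"
      by (simp add: vt algebra_simps eval_nat_numeral)
    also have "\<dots> \<le> (t * a^8) * (k^3 * (t^2 - t + 1))"
      using tpos by (intro mult_left_mono cubic_quadratic_quotient_mono tk) auto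
    also have "\<dots> = k^3 * a^4 * (t * (t^2 - t + 1) * a^4)"
      by (simp add: algebra_simps eval_nat_numeral)
    also have "\<dots> \<le> k^3 * a^4 * w"
      using w_ge k1 by (intro mult_left_mono) auto
    finally show ?thesis .
  next
    case False
    \<comment> \<open>The variance of the squared deviations is \<open>w - v^2\<close>.\<close>
    have "(\<Sum>i\<in>A. ((y i)^2 - v)^2) \<ge> 0" by (rule sum_nonneg) simp
    also have "(\<Sum>i\<in>A. ((y i)^2 - v)^2) = (\<Sum>i\<in>A. (y i)^4 - 2 * v * (y i)^2 + v^2)"
      by (rule sum.cong) (simp_all add: power2_eq_square power4_eq_xxxx algebra_simps)
    also have "\<dots> = real (card A) * (w - v^2)"
      by (simp add: sum.distrib sum_subtractf S2 S4 flip: sum_distrib_left)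
        (simp add: algebra_simps power2_eq_square)
    finally have w_ge: "v^2 \<le> w" using Npos by (simp add: zero_le_mult_iff)
    have "v^2 \<le> (a^2)^2"
      using False vpos apos by (intro power_mono) (auto simp: vt)
    then have va: "v^2 \<le> a^4" by simp
    \<comment> \<open>The quotient equals 1 at \<open>t = 1\<close>, so monotonicity up to
      \<open>k\<close> makes the constant at least 1.\<close>
    have "k^3 * (1^2 - 1 + 1) \<ge> 1^3 * (k^2 - k + 1)"
      by (rule cubic_quadratic_quotient_mono[OF k1])
    then have kk: "k^2 - k + 1 \<le> k^3" by simp
    have "v^4 * (k^2 - k + 1) = (k^2 - k + 1) * (v^2 * v^2)"
      by (simp add: algebra_simps flip: power_add)
    also have "\<dots> \<le> k^3 * (a^4 * w)"
      using kk va w_ge k1 apos by (intro mult_mono) auto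
    finally show ?thesis by (simp add: algebra_simps)
  qed
  have "N^2 - 3 * N + 3 = k^2 - k + 1"
    by (simp add: k_def power2_eq_square algebra_simps)
  moreover have "v^4 / w \<le> k^3 / (k^2 - k + 1) * a^4"
    using key wpos kq by (simp add: field_simps)
  ultimately show ?thesis by (simp only: k_def)
qed

theorem theorem2p8:
  fixes n :: nat and x :: "nat \<Rightarrow> real" and m M :: real
  assumes "n \<ge> 2"
    and "m \<le> M"
    and "\<And>i. i \<in> {1..n} \<Longrightarrow> m \<le> x i \<and> x i \<le> M"
    and "\<exists>i\<in>{1..n}. \<exists>j\<in>{1..n}. x i \<noteq> x j"
  shows "(central_moment 2 n x) ^ 4 / central_moment 4 n x
           \<le> (real n - 1) ^ 3 / (real n ^ 2 - 3 * real n + 3) * (amean n x - m) ^ 4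
       \<and> (central_moment 2 n x) ^ 4 / central_moment 4 n x
           \<le> (real n - 1) ^ 3 / (real n ^ 2 - 3 * real n + 3) * (M - amean n x) ^ 4"
proof -
  let ?y = "\<lambda>i. x i - amean n x"
  have sum0: "sum ?y {1..n} = 0"
    using assms(1) by (simp add: sum_subtractf amean_def)
  have sum0': "(\<Sum>i=1..n. - ?y i) = 0"
    using sum0 by (simp only: sum_negf)
  have nz: "\<exists>i\<in>{1..n}. ?y i \<noteq> 0"
    using assms(4) by (metis eq_iff_diff_eq_0)
  then have nz': "\<exists>i\<in>{1..n}. - ?y i \<noteq> 0" by (simp only: neg_equal_0_iff_equal not_False_eq_True)
  have lb: "- (amean n x - m) \<le> ?y i" and lb': "- (M - amean n x) \<le> - ?y i"
    if "i \<in> {1..n}" for i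
    using assms(3)[OF that] by simp_all
  \<comment> \<open>Simplification turns \<open>- ?y i\<close> into \<open>amean n x - x i\<close>;
    even powers ignore the sign, so both applications concern the same moments.\<close>
  have even: "(amean n x - x i)^2 = (?y i)^2" "(amean n x - x i)^4 = (?y i)^4" for i
    by (simp_all add: power2_commute power4_eq_xxxx algebra_simps)
  show ?thesis
    using moment_ratio_le[OF finite_atLeastAtMost sum0 lb nz]
      moment_ratio_le[OF finite_atLeastAtMost sum0' lb' nz']
    by (simp add: central_moment_def even)
qed

end
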